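(* For every integer $n\geq 1$, the polynomials $Q_n(x)$, $S_n(x)$ and $T_n(x)$ are all unimodal with modes in the middle; that is, each of these polynomials $f(x)$, of degree $d$ (where $d=2n-1$ for $Q_n$ and $S_n$, and $d=2n$ for $T_n$), is unimodal and has the index $\lfloor (d+1)/2\rfloor$ (which equals $n$ in all three cases) as a mode.
   Context: A polynomial $f(x)=\sum_{i=0}^d f_ix^i$ with nonnegative coefficients is unimodal with mode $m$ if $f_0\leq f_1\leq\cdots\leq f_m\geq f_{m+1}\geq\cdots\geq f_d$. Let $\mathfrak{D}_n$ be the set of permutations (rearrangements) $\sigma=\sigma_1\cdots\sigma_{2n+1}$ of the multiset $\{1,1,2,2,\ldots,n,n,n+1\}$. For $\sigma\in\mathfrak{D}_n$, $\mathrm{des}(\sigma)=\#\{i\in\{1,\ldots,2n\}:\sigma_i>\sigma_{i+1}\}$, and $Q_n(x)=\sum_{\sigma\in\mathfrak{D}_n}x^{\mathrm{des}(\sigma)}$. Let $\mathcal{C}_n^{\pm}$ be the set of all distinct signed permutations of the multiset $\{1,1,2,2,\ldots,n,n\}$, i.e. all words $\pm\sigma_1\pm\sigma_2\cdots\pm\sigma_{2n}$ with $\sigma_1\cdots\sigma_{2n}$ a permutation of $\{1,1,\ldots,n,n\}$ and each sign chosen arbitrarily. Let $\mathfrak{D}_n^{\pm}$ be the set of signed permutations of the multiset $\{1,1,2,2,\ldots,n,n,n+1\}$ in which the entry $n+1$ has a positive sign (equivalently, words obtained from an element of $\mathcal{C}_n^{\pm}$ by inserting the entry $n+1$). For a signed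 word $\sigma=\sigma_1\cdots\sigma_m$ set $\sigma_0=0$ and $\mathrm{des}_B(\sigma)=\#\{i\in\{0,1,\ldots,m-1\}:\sigma_i>\sigma_{i+1}\}$. Define $S_n(x)=\sum_{\sigma\in\mathcal{C}_n^{\pm}}x^{\mathrm{des}_B(\sigma)}$ and $T_n(x)=\sum_{\sigma\in\mathfrak{D}_n^{\pm}}x^{\mathrm{des}_B(\sigma)}$. *)

theory Defs
  imports
    Complex_Main
    "HOL-Combinatorics.Multiset_Permutations"
    "HOL-Computational_Algebra.Polynomial"
begin

definition unimodal_with_mode :: "real poly \<Rightarrow> nat \<Rightarrow> bool" where
  "unimodal_with_mode f m \<longleftrightarrow>
     (\<forall>i. 0 \<le> coeff f i) \<and> m \<le> degree f \<and>
     (\<forall>i<m. coeff f i \<le> coeff f (i + 1)) \<and>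
     (\<forall>i. m \<le> i \<and> i < degree f \<longrightarrow> coeff f (i + 1) \<le> coeff f i)"

text \<open>Words are lists, indexed from 0.\<close>

definition des :: "'a::linorder list \<Rightarrow> nat" where
  "des w = card {i. i + 1 < length w \<and> w ! i > w ! (i + 1)}"

text \<open>Prepending 0 implements the convention $\sigma_0 = 0$.\<close>

definition des_B :: "int list \<Rightarrow> nat" where
  "des_B w = des (0 # w)"

definition double_mset :: "nat \<Rightarrow> nat multiset" where
  "double_mset n = mset_set {1..n} + mset_set {1..n}"

text \<open>All words obtained from a permutation of \<open>M\<close> by choosing a sign for each entry;
  \<open>M\<close> is meant to consist of positive numbers.\<close>

definition signed_permutations_of_multiset :: "nat multiset \<Rightarrow> int list set" where
  "signed_permutations_of_multiset M =
     {w. map (\<lambda>k. nat \<bar>k\<bar>) w \<in> permutations_of_multiset M}"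

definition D_perms :: "nat \<Rightarrow> nat list set" where
  "D_perms n = permutations_of_multiset (add_mset (n + 1) (double_mset n))"

definition C_signed :: "nat \<Rightarrow> int list set" where
  "C_signed n = signed_permutations_of_multiset (double_mset n)"

definition D_signed :: "nat \<Rightarrow> int list set" where
  "D_signed n =
     {w \<in> signed_permutations_of_multiset (add_mset (n + 1) (double_mset n)).
        int (n + 1) \<in> set w}"

definition Q_poly :: "nat \<Rightarrow> real poly" where
  "Q_poly n = (\<Sum>w\<in>D_perms n. monom 1 (des w))"

definition S_poly :: "nat \<Rightarrow> real poly" where
  "S_poly n = (\<Sum>w\<in>C_signed n. monom 1 (des_B w))"

definition T_poly :: "nat \<Rightarrow> real poly" where
  "T_poly n = (\<Sum>w\<in>D_signed n. monom 1 (des_B w))"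

end

theory Submission
  imports Defs
begin

text \<open>
  Inserting a largest or a smallest letter into a word either keeps the number of descents or
  raises it by one, and the number of positions of the first kind depends only on the number of
  descents. Building words by inserting the letters \<open>1, 1, 2, 2, \<dots>\<close> (with signs) therefore gives
  two-term recurrences for the descent numbers. These recurrences preserve the chain
  \<open>h 0 \<le> h N \<le> h 1 \<le> h (N - 1) \<le> \<dots>\<close>, which is stronger than unimodality with the mode in the
  middle. The one exception is the second insertion of an unsigned letter, where the palindromicity
  of the descent numbers of \<open>{1, 1, \<dots>, n, n}\<close> is used as well.
\<close>

section \<open>Alternatingly increasing sequences\<close>

text \<open>Integer indices and vanishing outside \<open>0..N\<close> let the shift
  \<open>k - 1\<close> and the reflection \<open>N - k\<close> go through without truncation; at
  negative \<open>k\<close> the inequalities compare with zero terms and hold by themselves.\<close>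

definition alternatingly_increasing :: "int \<Rightarrow> (int \<Rightarrow> real) \<Rightarrow> bool" where
  "alternatingly_increasing N h \<longleftrightarrow>
     (\<forall>k. k < 0 \<or> N < k \<longrightarrow> h k = 0) \<and> (\<forall>k. 0 \<le> h k) \<and>
     (\<forall>k. 2 * k \<le> N \<longrightarrow> h k \<le> h (N - k)) \<and>
     (\<forall>k. 2 * k + 1 \<le> N \<longrightarrow> h (N - k) \<le> h (k + 1))"

lemma
  assumes "alternatingly_increasing N h"
  shows alternatingly_increasing_zero: "k < 0 \<or> N < k \<Longrightarrow> h k = 0"
    and alternatingly_increasing_nonneg: "0 \<le> h k"
    and alternatingly_increasing_low: "2 * k \<le> N \<Longrightarrow> h k \<le> h (N - k)"
    and alternatingly_increasing_high: "2 * k + 1 \<le> N \<Longrightarrow> h (N - k) \<le> h (k + 1)"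
  using assms unfolding alternatingly_increasing_def by blast+

lemma alternatingly_increasing_mono:
  assumes h: "alternatingly_increasing N h" and k: "2 * k + 1 \<le> N"
  shows "h k \<le> h (k + 1)"
proof -
  have "h k \<le> h (N - k)"
    by (rule alternatingly_increasing_low[OF h]) (use k in linarith)
  also have "\<dots> \<le> h (k + 1)"
    by (rule alternatingly_increasing_high[OF h k])
  finally show ?thesis .
qed

lemma alternatingly_increasing_antimono:
  assumes h: "alternatingly_increasing N h" and k: "N \<le> 2 * k"
  shows "h (k + 1) \<le> h k"
proof -
  \<comment> \<open>Past the middle the same chain is read at the reflected indices
    \<open>N - k - 1\<close> and \<open>N - k\<close>.\<close>
  have "h (N - (N - k - 1)) \<le> h (N - k - 1 + 1)"
    by (rule alternatingly_increasing_high[OF h]) (use k in simp)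
  also have "\<dots> \<le> h (N - (N - k))"
    using alternatingly_increasing_low[OF h, of "N - k"] k by simp
  finally show ?thesis
    by (simp add: algebra_simps)
qed

text \<open>The first link \<open>h 0 \<le> h N\<close> carries positivity to the top index, so the
  degree is exactly \<open>N\<close>. The bound \<open>(N + 1) div 2\<close> is where
  \<open>2 * i + 1 \<le> N\<close> turns into \<open>N \<le> 2 * i\<close>.\<close>

lemma unimodal_if_alternatingly_increasing:
  fixes f :: "real poly"
  assumes h: "alternatingly_increasing (int N) h"
    and coeff: "\<And>i. coeff f i = h (int i)" and pos: "0 < h 0"
  shows "degree f = N \<and> unimodal_with_mode f ((N + 1) div 2)"
proof -
  have "0 < coeff f N"
    using alternatingly_increasing_low[OF h, of 0] pos by (simp add: coeff)
  moreover have "coeff f i = 0" if "N < i" for i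
    using alternatingly_increasing_zero[OF h, of "int i"] that by (simp add: coeff)
  ultimately have deg: "degree f = N"
    by (metis degree_le le_antisym le_degree less_numeral_extra(3))
  have "coeff f i \<le> coeff f (i + 1)" if "i < (N + 1) div 2" for i
    using alternatingly_increasing_mono[OF h, of "int i"] that by (simp add: coeff add.commute)
  moreover have "coeff f (i + 1) \<le> coeff f i" if "(N + 1) div 2 \<le> i" for i
    using alternatingly_increasing_antimono[OF h, of "int i"] that by (simp add: coeff add.commute)
  moreover have "0 \<le> coeff f i" for i
    by (simp add: coeff alternatingly_increasing_nonneg[OF h])
  ultimately show ?thesis
    unfolding unimodal_with_mode_def deg by auto
qed

text \<open>
  If \<open>h\<close> is the numerator of \<open>\<Sum>m. p m * x ^ m\<close> over \<open>(1 - x) ^ (d + 1)\<close>, then the right-hand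
  side of the recurrence is the numerator for \<open>(m + a) * p m\<close> over \<open>(1 - x) ^ (d + 2)\<close>.
\<close>

lemma alternatingly_increasing_step:
  fixes a :: real and d N :: int
  assumes h: "alternatingly_increasing N h"
    and rec: "\<And>k. h' k = (k + a) * h k + (d + 2 - k - a) * h (k - 1)"
    and a: "0 \<le> a" "d - N \<le> 2 * a" "2 * a \<le> d - N + 1" and N: "-1 \<le> N"
  shows "alternatingly_increasing (N + 1) h'"
  unfolding alternatingly_increasing_def
proof (intro conjI allI impI)
  note low = alternatingly_increasing_low[OF h] and high = alternatingly_increasing_high[OF h]
    and zero = alternatingly_increasing_zero[OF h] and nonneg = alternatingly_increasing_nonneg[OF h]
  show zero': "h' k = 0" if "k < 0 \<or> N + 1 < k" for k
    using that zero[of k] zero[of "k - 1"] by (auto simp: rec)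
  show "0 \<le> h' k" for k
  proof (cases "0 \<le> k \<and> k \<le> N + 1")
    case True
    then have "0 \<le> real_of_int k" "real_of_int k \<le> real_of_int N + 1"
      by linarith+
    then have "0 \<le> real_of_int k + a" "0 \<le> real_of_int d + 2 - real_of_int k - a"
      using a by linarith+
    then show ?thesis
      unfolding rec using nonneg by simp
  qed (use zero' in auto)
  show "h' k \<le> h' (N + 1 - k)" if k: "2 * k \<le> N + 1" for k
  proof -
    consider "k < 0" | "2 * k = N + 1" | "0 \<le> k" "2 * k \<le> N"
      using k by linarith
    then show ?thesis
    proof cases
      case 1
      then show ?thesis using zero'[of k] zero'[of "N + 1 - k"] by simp
    next
      case 2
      then have "N + 1 - k = k" by simp
      then show ?thesis by simp
    next
      case 3
      have le: "h k \<le> h (N - k)" "h (k - 1) \<le> h (N + 1 - k)" "h (N + 1 - k) \<le> h k"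
        using low[of k] low[of "k - 1"] high[of "k - 1"] 3 by (simp_all add: algebra_simps)
      \<comment> \<open>Each factor in \<open>h\<close> is a difference of two terms of the chain
        \<open>h (k - 1) \<le> h (N + 1 - k) \<le> h k \<le> h (N - k)\<close>. The middle
        coefficient is nonnegative exactly by the upper bound on \<open>2 * a\<close>.\<close>
      have "h' (N + 1 - k) - h' k = (k + a) * (h (N - k) - h k)
          + (d + 1 - N - 2 * a) * (h (N - k) - h (k - 1))
          + (N + 1 - k + a) * (h (N + 1 - k) - h (k - 1))"
        unfolding rec by (simp add: algebra_simps)
      moreover have "0 \<le> (k + a) * (h (N - k) - h k)"
        using le 3 a by (intro mult_nonneg_nonneg) auto
      moreover have "0 \<le> (d + 1 - N - 2 * a) * (h (N - k) - h (k - 1))"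
        using le a by (intro mult_nonneg_nonneg) linarith+
      moreover have "0 \<le> (N + 1 - k + a) * (h (N + 1 - k) - h (k - 1))"
        using le 3 a by (intro mult_nonneg_nonneg) linarith+
      ultimately show ?thesis by linarith
    qed
  qed
  show "h' (N + 1 - k) \<le> h' (k + 1)" if k: "2 * k + 1 \<le> N + 1" for k
  proof -
    consider "k < 0" | "2 * k = N" | "0 \<le> k" "2 * k + 1 \<le> N"
      using k by linarith
    then show ?thesis
    proof cases
      case 1
      then have "h' (N + 1 - k) = 0" using zero'[of "N + 1 - k"] by simp
      then show ?thesis using \<open>\<And>k. 0 \<le> h' k\<close> by simp
    next
      case 2
      then have "N + 1 - k = k + 1" by simp
      then show ?thesis by simp
    next
      case 3
      have le: "h (N - k) \<le> h (k + 1)" "h k \<le> h (N - k)" "h (N + 1 - k) \<le> h k"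
        using low[of k] high[of k] high[of "k - 1"] 3 by (simp_all add: algebra_simps)
      \<comment> \<open>Same device for the chain
        \<open>h (N + 1 - k) \<le> h k \<le> h (N - k) \<le> h (k + 1)\<close>; here the middle
        coefficient needs the lower bound on \<open>2 * a\<close>.\<close>
      have "h' (k + 1) - h' (N + 1 - k) = (d + 1 - N + k - a) * (h (k + 1) - h (N - k))
          + (N + 2 * a - d) * (h (k + 1) - h (N + 1 - k))
          + (d + 1 - k - a) * (h k - h (N + 1 - k))"
        unfolding rec by (simp add: algebra_simps)
      moreover have "0 \<le> (d + 1 - N + k - a) * (h (k + 1) - h (N - k))"
        using le 3 a by (intro mult_nonneg_nonneg) linarith+
      moreover have "0 \<le> (N + 2 * a - d) * (h (k + 1) - h (N + 1 - k))"
        using le a by (intro mult_nonneg_nonneg) linarith+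
      moreover have "0 \<le> (d + 1 - k - a) * (h k - h (N + 1 - k))"
        using le 3 a by (intro mult_nonneg_nonneg) linarith+
      ultimately show ?thesis by linarith
    qed
  qed
qed


section \<open>Descents under insertion of an extreme letter\<close>

text \<open>The prefixed letter \<open>p\<close> serves both settings: \<open>p = 0\<close> is the
  convention of \<open>des_B\<close>, and in front of a word of natural numbers 0 creates no
  descent.\<close>

definition des_count :: "'a::linorder \<Rightarrow> 'a list set \<Rightarrow> int \<Rightarrow> real" where
  "des_count p W k = (\<Sum>w\<in>W. of_bool (int (des (p # w)) = k))"

lemma coeff_sum_monom_des:
  "coeff (\<Sum>w\<in>W. monom 1 (des (p # w))) i = des_count p W (int i)"
  by (simp add: des_count_def coeff_sum of_bool_def)

lemma des_count_nonneg: "0 \<le> des_count p W k"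
  by (simp add: des_count_def sum_nonneg)

lemma des_count_neg: "k < 0 \<Longrightarrow> des_count p W k = 0"
  by (simp add: des_count_def)

lemma des_Nil [simp]: "des [] = 0"
  by (simp add: des_def)

lemma des_singleton [simp]: "des [x] = 0"
  by (simp add: des_def)

lemma des_Cons_Cons [simp]: "des (x # y # w) = of_bool (x > y) + des (y # w)"
proof -
  let ?A = "{i. i + 1 < length (y # w) \<and> (y # w) ! i > (y # w) ! (i + 1)}"
  have "{i. i + 1 < length (x # y # w) \<and> (x # y # w) ! i > (x # y # w) ! (i + 1)}
      = (if x > y then {0} else {}) \<union> Suc ` ?A" (is "?B = _")
  proof (rule set_eqI)
    fix i show "i \<in> ?B \<longleftrightarrow> i \<in> (if x > y then {0} else {}) \<union> Suc ` ?A"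
      by (cases i) auto
  qed
  moreover have "finite ?A"
    by (rule finite_subset[of _ "{..length (y # w)}"]) auto
  ultimately show ?thesis
    unfolding des_def by (subst card_Un_disjoint | auto simp: card_image)+
qed

lemma des_count_empty_word [simp]: "des_count p {[]} k = of_bool (k = 0)"
  by (simp add: des_count_def)

lemma des_count_Un:
  assumes "finite V" "finite W" "V \<inter> W = {}"
  shows "des_count p (V \<union> W) k = des_count p V k + des_count p W k"
  unfolding des_count_def by (rule sum.union_disjoint[OF assms])

section \<open>Sums over all insertion positions\<close>

definition insert_at :: "nat \<Rightarrow> 'a \<Rightarrow> 'a list \<Rightarrow> 'a list" where
  "insert_at j x w = take j w @ x # drop j w"

text \<open>A largest letter keeps the number of descents when it enters a descent, stands last, or
  comes directly before a copy of itself; these cases are disjoint. Every other gap gains a descent.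
  The function \<open>f\<close> is arbitrary so that the induction can absorb the possible descent
  from \<open>p\<close> to the first letter.\<close>

lemma sum_des_insert_max:
  fixes f :: "nat \<Rightarrow> real"
  assumes "\<forall>y\<in>set (p # w). y \<le> x"
  shows "(\<Sum>j\<le>length w. f (des (p # insert_at j x w))) =
     (des (p # w) + 1 + count_list w x) * f (des (p # w))
     + (real (length w) - des (p # w) - count_list w x) * f (des (p # w) + 1)"
  using assms
proof (induction w arbitrary: p f)
  case Nil
  then show ?case by (auto simp: insert_at_def dest: leD)
next
  case (Cons y w)
  have "(\<Sum>j\<le>length (y # w). f (des (p # insert_at j x (y # w)))) =
      f (des (p # x # y # w))
      + (\<Sum>j\<le>length w. f (of_bool (p > y) + des (y # insert_at j x w)))"
    by (simp add: sum.atMost_Suc_shift insert_at_def del: sum.atMost_Suc)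
  also have "(\<Sum>j\<le>length w. f (of_bool (p > y) + des (y # insert_at j x w))) =
     (des (y # w) + 1 + count_list w x) * f (of_bool (p > y) + des (y # w))
     + (real (length w) - des (y # w) - count_list w x) * f (of_bool (p > y) + (des (y # w) + 1))"
    by (rule Cons.IH) (use Cons.prems in auto)
  finally show ?case
    using Cons.prems by (cases "p > y"; cases "x = y") (auto simp: algebra_simps)
qed

text \<open>Here the gaps that keep the number of descents are the descents and the gaps directly
  after a copy of \<open>x\<close>. The end of the word is no longer special, and \<open>p\<close>
  itself may be such a copy.\<close>

lemma sum_des_insert_min:
  fixes f :: "nat \<Rightarrow> real"
  assumes "\<forall>y\<in>set (p # w). x \<le> y"
  shows "(\<Sum>j\<le>length w. f (des (p # insert_at j x w))) =
     (des (p # w) + count_list (p # w) x) * f (des (p # w))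
     + (real (length w) + 1 - des (p # w) - count_list (p # w) x) * f (des (p # w) + 1)"
  using assms
proof (induction w arbitrary: p f)
  case Nil
  then show ?case by (auto simp: insert_at_def dest: leD)
next
  case (Cons y w)
  have "(\<Sum>j\<le>length (y # w). f (des (p # insert_at j x (y # w)))) =
      f (des (p # x # y # w))
      + (\<Sum>j\<le>length w. f (of_bool (p > y) + des (y # insert_at j x w)))"
    by (simp add: sum.atMost_Suc_shift insert_at_def del: sum.atMost_Suc)
  also have "(\<Sum>j\<le>length w. f (of_bool (p > y) + des (y # insert_at j x w))) =
     (des (y # w) + count_list (y # w) x) * f (of_bool (p > y) + des (y # w))
     + (real (length w) + 1 - des (y # w) - count_list (y # w) x)
        * f (of_bool (p > y) + (des (y # w) + 1))"
    by (rule Cons.IH) (use Cons.prems in auto)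
  finally show ?case
    using Cons.prems by (cases "p > y"; cases "x = p"; cases "x = y") (auto simp: algebra_simps)
qed

text \<open>Both sides count the words in \<open>V\<close> with one marked occurrence of \<open>x\<close>.\<close>

lemma sum_insert_at:
  fixes g :: "'a list \<Rightarrow> real"
  assumes VW: "\<And>ys zs. ys @ x # zs \<in> V \<longleftrightarrow> ys @ zs \<in> W"
    and "finite V" "finite W" and c: "\<And>v. v \<in> V \<Longrightarrow> count_list v x = c"
  shows "c * (\<Sum>v\<in>V. g v) = (\<Sum>w\<in>W. \<Sum>j\<le>length w. g (insert_at j x w))"
proof -
  have "c * (\<Sum>v\<in>V. g v) = (\<Sum>v\<in>V. \<Sum>j | j < length v \<and> v ! j = x. g v)"
    unfolding sum_distrib_left
  proof (rule sum.cong)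
    fix v assume "v \<in> V"
    then have "card {j. j < length v \<and> v ! j = x} = c"
      using c[of v] count_list_eq_length_filter[of v x] length_filter_conv_card[of "(=) x" v]
      by (simp add: eq_commute[of x])
    then show "c * g v = (\<Sum>j | j < length v \<and> v ! j = x. g v)" by simp
  qed simp
  also have "\<dots> = (\<Sum>(v, j)\<in>(SIGMA v:V. {j. j < length v \<and> v ! j = x}). g v)"
    using \<open>finite V\<close> by (intro sum.Sigma) auto
  also have "\<dots> = (\<Sum>(w, j)\<in>(SIGMA w:W. {..length w}). g (insert_at j x w))"
  \<comment> \<open>Deleting the marked letter but remembering its position \<open>j\<close> is
    inverse to inserting \<open>x\<close> at gap \<open>j\<close>.\<close>
  proof (rule sum.reindex_bij_witness
      [where j = "\<lambda>(v, j). (take j v @ drop (Suc j) v, j)" and i = "\<lambda>(w, j). (insert_at j x w, j)"])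
    fix a assume "a \<in> (SIGMA v:V. {j. j < length v \<and> v ! j = x})"
    then obtain v j where a: "a = (v, j)" "v \<in> V" "j < length v" "v ! j = x" by auto
    have v: "take j v @ x # drop (Suc j) v = v" using a id_take_nth_drop by metis
    then have W: "take j v @ drop (Suc j) v \<in> W" using VW a by metis
    have ins: "insert_at j x (take j v @ drop (Suc j) v) = v"
      using a v by (simp add: insert_at_def min_def)
    show "(\<lambda>(w, j). (insert_at j x w, j)) ((\<lambda>(v, j). (take j v @ drop (Suc j) v, j)) a) = a"
      using a ins by simp
    show "(\<lambda>(v, j). (take j v @ drop (Suc j) v, j)) a \<in> (SIGMA w:W. {..length w})"
      using a W by (simp add: min_def)
    show "(case (\<lambda>(v, j). (take j v @ drop (Suc j) v, j)) a of (w, j) \<Rightarrow> g (insert_at j x w))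
        = (case a of (v, j) \<Rightarrow> g v)"
      using a ins by simp
  next
    fix b assume "b \<in> (SIGMA w:W. {..length w})"
    then obtain w j where b: "b = (w, j)" "w \<in> W" "j \<le> length w" by auto
    then show "(\<lambda>(v, j). (take j v @ drop (Suc j) v, j)) ((\<lambda>(w, j). (insert_at j x w, j)) b) = b"
      by (simp add: insert_at_def min_def)
    have "insert_at j x w \<in> V"
      unfolding insert_at_def VW using b by simp
    then show "(\<lambda>(w, j). (insert_at j x w, j)) b \<in> (SIGMA v:V. {j. j < length v \<and> v ! j = x})"
      using b by (simp add: insert_at_def nth_append min_def)
  qed
  also have "\<dots> = (\<Sum>w\<in>W. \<Sum>j\<le>length w. g (insert_at j x w))"
    using \<open>finite W\<close> by (intro sum.Sigma[symmetric]) auto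
  finally show ?thesis .
qed

text \<open>Double counting with the indicator of having \<open>k\<close> descents as weight: a word
  of \<open>W\<close> with \<open>k\<close> descents contributes \<open>k + a\<close>, one with
  \<open>k - 1\<close> descents contributes \<open>b - (k - 1)\<close>. The factor \<open>c\<close>
  remains because each word of \<open>V\<close> arises once per copy of \<open>x\<close>.\<close>

lemma des_count_insert:
  fixes a b :: real
  assumes VW: "\<And>ys zs. ys @ x # zs \<in> V \<longleftrightarrow> ys @ zs \<in> W"
    and fin: "finite V" "finite W" and c: "\<And>v. v \<in> V \<Longrightarrow> count_list v x = c"
    and ins: "\<And>w f. w \<in> W \<Longrightarrow> (\<Sum>j\<le>length w. f (des (p # insert_at j x w)) :: real) =
      (des (p # w) + a) * f (des (p # w)) + (b - des (p # w)) * f (des (p # w) + 1)"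
  shows "c * des_count p V k = (k + a) * des_count p W k + (b + 1 - k) * des_count p W (k - 1)"
proof -
  have "c * des_count p V k =
      (\<Sum>w\<in>W. \<Sum>j\<le>length w. of_bool (int (des (p # insert_at j x w)) = k))"
    unfolding des_count_def by (rule sum_insert_at[OF VW fin c])
  also have "\<dots> = (\<Sum>w\<in>W. (k + a) * of_bool (int (des (p # w)) = k)
      + (b + 1 - k) * of_bool (int (des (p # w)) = k - 1))"
  proof (rule sum.cong)
    fix w assume w: "w \<in> W"
    show "(\<Sum>j\<le>length w. of_bool (int (des (p # insert_at j x w)) = k)) =
        (k + a) * of_bool (int (des (p # w)) = k)
        + (b + 1 - k) * of_bool (int (des (p # w)) = k - 1)"
      unfolding ins[OF w, where f = "\<lambda>i. of_bool (int i = k)"] by auto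
  qed simp
  finally show ?thesis
    by (simp add: des_count_def sum.distrib sum_distrib_left)
qed

lemma des_count_insert_max:
  assumes VW: "\<And>ys zs. ys @ x # zs \<in> V \<longleftrightarrow> ys @ zs \<in> W"
    and fin: "finite V" "finite W" and c: "\<And>v. v \<in> V \<Longrightarrow> count_list v x = Suc c"
    and W: "\<And>w. w \<in> W \<Longrightarrow> length w = L \<and> (\<forall>y\<in>set (p # w). y \<le> x)"
  shows "(c + 1) * des_count p V k =
    (of_int k + 1 + real c) * des_count p W k + (real L + 1 - k - c) * des_count p W (k - 1)"
proof -
  \<comment> \<open>Putting \<open>x\<close> in front of \<open>w\<close> gives a word of
    \<open>V\<close>, so \<open>w\<close> has one copy fewer.\<close>
  have cW: "count_list w x = c" if "w \<in> W" for w
    using c[of "x # w"] VW[of "[]" w] that by simp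
  have "Suc c * des_count p V k =
    (k + real (1 + c)) * des_count p W k + ((real L - c) + 1 - k) * des_count p W (k - 1)"
  proof (rule des_count_insert[OF VW fin c])
    fix w and f :: "nat \<Rightarrow> real"
    assume w: "w \<in> W"
    show "(\<Sum>j\<le>length w. f (des (p # insert_at j x w))) =
      (des (p # w) + real (1 + c)) * f (des (p # w))
      + (real L - c - des (p # w)) * f (des (p # w) + 1)"
      using sum_des_insert_max[of p w x f] W[OF w] cW[OF w] by (simp add: algebra_simps)
  qed
  then show ?thesis by (simp add: algebra_simps)
qed

text \<open>Strictness of \<open>x < p\<close> keeps the prefix from counting as a copy of
  \<open>x\<close>.\<close>

lemma des_count_insert_min:
  assumes VW: "\<And>ys zs. ys @ x # zs \<in> V \<longleftrightarrow> ys @ zs \<in> W"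
    and fin: "finite V" "finite W" and c: "\<And>v. v \<in> V \<Longrightarrow> count_list v x = Suc c"
    and W: "\<And>w. w \<in> W \<Longrightarrow> length w = L \<and> (\<forall>y\<in>set w. x \<le> y)" and p: "x < p"
  shows "(c + 1) * des_count p V k =
    (of_int k + real c) * des_count p W k + (real L + 2 - k - c) * des_count p W (k - 1)"
proof -
  have cW: "count_list w x = c" if "w \<in> W" for w
    using c[of "x # w"] VW[of "[]" w] that by simp
  have "Suc c * des_count p V k =
    (k + real c) * des_count p W k + ((real L + 1 - c) + 1 - k) * des_count p W (k - 1)"
  proof (rule des_count_insert[OF VW fin c])
    fix w and f :: "nat \<Rightarrow> real"
    assume w: "w \<in> W"
    show "(\<Sum>j\<le>length w. f (des (p # insert_at j x w))) =
      (des (p # w) + real c) * f (des (p # w))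
      + (real L + 1 - c - des (p # w)) * f (des (p # w) + 1)"
      using sum_des_insert_min[of p w x f] W[OF w] cW[OF w] less_imp_le[OF p] less_imp_neq[OF p]
      by (simp add: algebra_simps)
  qed
  then show ?thesis by (simp add: algebra_simps)
qed


section \<open>Unsigned words\<close>

abbreviation C_perms :: "nat \<Rightarrow> nat list set" where
  "C_perms n \<equiv> permutations_of_multiset (double_mset n)"

lemma double_mset_0 [simp]: "double_mset 0 = {#}"
  by (simp add: double_mset_def)

lemma double_mset_Suc: "double_mset (Suc n) = add_mset (Suc n) (add_mset (Suc n) (double_mset n))"
  by (simp add: double_mset_def atLeastAtMostSuc_conv)

lemma in_double_mset: "k \<in># double_mset n \<longleftrightarrow> 1 \<le> k \<and> k \<le> n"
  by (simp add: double_mset_def)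

lemma size_double_mset [simp]: "size (double_mset n) = 2 * n"
  by (simp add: double_mset_def)

lemma count_list_mset: "count_list w x = count (mset w) x"
  by (induction w) auto

lemma count_double_mset_Suc: "count (double_mset n) (Suc n) = 0"
  using in_double_mset[of "Suc n" n] by (simp add: not_in_iff)

text \<open>Insertion of the first copy of \<open>n + 1\<close> into words of length
  \<open>2 * n\<close>.\<close>

lemma des_count_D_perms:
  "des_count 0 (D_perms n) k =
     (k + 1) * des_count 0 (C_perms n) k + (2 * real n + 1 - k) * des_count 0 (C_perms n) (k - 1)"
proof -
  have "(real 0 + 1) * des_count 0 (D_perms n) k =
      (of_int k + 1 + real 0) * des_count 0 (C_perms n) k
      + (real (2 * n) + 1 - k - real 0) * des_count 0 (C_perms n) (k - 1)"
  proof (rule des_count_insert_max[where x = "Suc n"])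
    fix w assume "w \<in> C_perms n"
    then have "mset w = double_mset n" by (simp add: permutations_of_multiset_def)
    then show "length w = 2 * n \<and> (\<forall>y\<in>set (0 # w). y \<le> Suc n)"
      using in_double_mset[of _ n] by (auto simp flip: size_mset set_mset_mset)
  qed (auto simp: D_perms_def permutations_of_multiset_def count_list_mset count_double_mset_Suc
      intro: finite_permutations_of_multiset[unfolded permutations_of_multiset_def])
  then show ?thesis by simp
qed

text \<open>Insertion of the second copy; each resulting word arises twice, hence the factor
  2.\<close>

lemma des_count_C_perms_Suc:
  "2 * des_count 0 (C_perms (Suc n)) k =
     (k + 2) * des_count 0 (D_perms n) k + (2 * real n + 1 - k) * des_count 0 (D_perms n) (k - 1)"
proof -
  have "(real 1 + 1) * des_count 0 (C_perms (Suc n)) k =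
      (of_int k + 1 + real 1) * des_count 0 (D_perms n) k
      + (real (2 * n + 1) + 1 - k - real 1) * des_count 0 (D_perms n) (k - 1)"
  proof (rule des_count_insert_max[where x = "Suc n"])
    fix w assume "w \<in> D_perms n"
    then have "mset w = add_mset (Suc n) (double_mset n)"
      by (simp add: D_perms_def permutations_of_multiset_def)
    then show "length w = 2 * n + 1 \<and> (\<forall>y\<in>set (0 # w). y \<le> Suc n)"
      using in_double_mset[of _ n] by (auto simp flip: size_mset set_mset_mset)
  qed (auto simp: D_perms_def double_mset_Suc permutations_of_multiset_def count_list_mset
      count_double_mset_Suc
      intro: finite_permutations_of_multiset[unfolded permutations_of_multiset_def])
  then show ?thesis by (simp add: algebra_simps)
qed

lemma des_count_C_perms_pos: "0 < des_count 0 (C_perms n) 0"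
proof (induction n)
  case 0
  show ?case by simp
next
  case (Suc n)
  then show ?case
    using des_count_C_perms_Suc[of n 0] by (simp add: des_count_D_perms des_count_neg)
qed

text \<open>The second insertion would need \<open>a = 2\<close>, \<open>d = 2 * n + 3\<close>,
  \<open>N = 2 * n + 1\<close> in \<open>alternatingly_increasing_step\<close>, which violates
  \<open>2 * a \<le> d - N + 1\<close>. Palindromicity, carried along the induction, replaces it:
  one family of inequalities becomes equalities and the other becomes monotonicity up to the
  middle.\<close>

lemma alternatingly_increasing_C_perms:
  "alternatingly_increasing (2 * int n) (des_count 0 (C_perms (Suc n))) \<and>
   (\<forall>k. des_count 0 (C_perms (Suc n)) (2 * int n - k) = des_count 0 (C_perms (Suc n)) k)"
proof (induction n)
  case 0
  have "des_count 0 (C_perms (Suc 0)) k = of_bool (k = 0)" for k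
    using des_count_C_perms_Suc[of 0 k]
    by (auto simp: des_count_D_perms of_bool_def split: if_splits)
  then show ?case
    by (simp add: alternatingly_increasing_def)
next
  case (Suc n)
  define p where "p = des_count 0 (C_perms (Suc n))"
  define q where "q = des_count 0 (D_perms (Suc n))"
  define r where "r = des_count 0 (C_perms (Suc (Suc n)))"
  have p: "alternatingly_increasing (2 * int n) p" and p_sym: "p (2 * int n - k) = p k" for k
    using Suc.IH by (simp_all add: p_def)
  have q_rec: "q k = (of_int k + 1) * p k + (2 * real n + 3 - of_int k) * p (k - 1)" for k
    using des_count_D_perms[of "Suc n" k] by (simp add: p_def q_def algebra_simps)
  have r_rec: "2 * r k = (of_int k + 2) * q k + (2 * real n + 3 - of_int k) * q (k - 1)" for k
    using des_count_C_perms_Suc[of "Suc n" k] by (simp add: q_def r_def algebra_simps)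
  have q: "alternatingly_increasing (2 * int n + 1) q"
    by (rule alternatingly_increasing_step[OF p, where a = 1 and d = "2 * int n + 2"])
      (simp_all add: q_rec algebra_simps)
  \<comment> \<open>The intermediate \<open>q\<close> is not palindromic in general, so both
    recurrences are unfolded down to the palindromic \<open>p\<close>.\<close>
  have r_sym: "r (2 * int n + 2 - k) = r k" for k
  proof -
    have "p (2 * int n + 2 - k) = p (k - 2)" "p (2 * int n + 1 - k) = p (k - 1)"
      "p (2 * int n - k) = p k"
      using p_sym[of "k - 2"] p_sym[of "k - 1"] p_sym[of k] by (simp_all add: algebra_simps)
    then have "2 * r (2 * int n + 2 - k) = 2 * r k"
      unfolding r_rec q_rec by (simp add: algebra_simps)
    then show ?thesis by simp
  qed
  have zero: "r k = 0" if "k < 0 \<or> 2 * int n + 2 < k" for k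
    using that r_rec[of k] alternatingly_increasing_zero[OF q, of k]
      alternatingly_increasing_zero[OF q, of "k - 1"] by auto
  have nonneg: "0 \<le> r k" for k
    by (simp add: r_def des_count_nonneg)
  have mono: "r k \<le> r (k + 1)" if k: "k \<le> int n" for k
  proof (cases "k < 0")
    case True
    then show ?thesis using zero[of k] nonneg by simp
  next
    case False
    have le: "q (k - 1) \<le> q k" "q k \<le> q (k + 1)"
      using alternatingly_increasing_mono[OF q, of k] alternatingly_increasing_mono[OF q, of "k - 1"] k
      by simp_all
    \<comment> \<open>The recurrence difference is regrouped into increments of \<open>q\<close>,
      which increases up to index \<open>n + 1\<close>.\<close>
    have "2 * r (k + 1) - 2 * r k =
        (of_int k + 3) * (q (k + 1) - q (k - 1)) + (2 * (real n - of_int k)) * (q k - q (k - 1))"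
      unfolding r_rec by (simp add: algebra_simps)
    also have "\<dots> \<ge> 0"
      using le k False by (intro add_nonneg_nonneg mult_nonneg_nonneg) linarith+
    finally show ?thesis by simp
  qed
  have "r (2 * int n + 2 - k) \<le> r (k + 1)" if "2 * k + 1 \<le> 2 * int n + 2" for k
    using mono[of k] r_sym[of k] that by simp
  then have "alternatingly_increasing (2 * int n + 2) r"
    using zero nonneg r_sym by (auto simp: alternatingly_increasing_def)
  then show ?case
    using r_sym by (simp add: r_def add.commute)
qed

lemma alternatingly_increasing_D_perms:
  "alternatingly_increasing (2 * int n + 1) (des_count 0 (D_perms (Suc n)))"
  by (rule alternatingly_increasing_step
      [OF conjunct1[OF alternatingly_increasing_C_perms], where a = 1 and d = "2 * int n + 2"])
    (simp_all add: des_count_D_perms algebra_simps)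

lemma des_Cons_0_nat: "des (0 # w) = des (w :: nat list)"
  by (cases w) simp_all


section \<open>Signed words\<close>

text \<open>Here \<open>a\<close> and \<open>b\<close> count the letters \<open>n + 1\<close> and \<open>-(n + 1)\<close>, respectively.\<close>

definition signed_words :: "nat \<Rightarrow> nat \<Rightarrow> nat \<Rightarrow> int list set" where
  "signed_words n a b =
     {w. mset (map (\<lambda>k. nat \<bar>k\<bar>) w) = double_mset n + replicate_mset (a + b) (Suc n) \<and>
         count_list w (int (Suc n)) = a \<and> count_list w (- int (Suc n)) = b}"

lemma signed_words_bounds:
  assumes "w \<in> signed_words n a b"
  shows "length w = 2 * n + a + b" and "y \<in> set w \<Longrightarrow> \<bar>y\<bar> \<le> int (Suc n)"
proof -
  have eq: "mset (map (\<lambda>k. nat \<bar>k\<bar>) w) = double_mset n + replicate_mset (a + b) (Suc n)"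
    using assms by (simp add: signed_words_def)
  from arg_cong[OF eq, of size] show "length w = 2 * n + a + b"
    by (simp del: mset_map)
  show "\<bar>y\<bar> \<le> int (Suc n)" if "y \<in> set w"
  proof -
    have "nat \<bar>y\<bar> \<in># mset (map (\<lambda>k. nat \<bar>k\<bar>) w)" using that by auto
    then have "nat \<bar>y\<bar> \<le> Suc n"
      unfolding eq by (auto simp: in_double_mset split: if_splits)
    then show ?thesis by simp
  qed
qed

lemma finite_signed_words: "finite (signed_words n a b)"
proof (rule finite_subset)
  show "signed_words n a b
      \<subseteq> {w. set w \<subseteq> {- int (Suc n)..int (Suc n)} \<and> length w = 2 * n + a + b}"
    using signed_words_bounds by (fastforce simp: abs_le_iff)
qed (simp add: finite_lists_length_eq)

lemma count_list_abs:
  assumes "m > 0"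
  shows "count (mset (map (\<lambda>k. nat \<bar>k\<bar>) w)) m = count_list w (int m) + count_list w (- int m)"
  using assms by (induction w) auto

lemma C_signed_eq: "C_signed n = signed_words n 0 0"
proof -
  have "count_list w (int (Suc n)) = 0 \<and> count_list w (- int (Suc n)) = 0"
    if "mset (map (\<lambda>k. nat \<bar>k\<bar>) w) = double_mset n" for w
    using count_list_abs[of "Suc n" w] that by (simp add: count_double_mset_Suc del: mset_map)
  then show ?thesis
    by (auto simp: C_signed_def signed_permutations_of_multiset_def signed_words_def
        permutations_of_multiset_def simp del: mset_map)
qed

lemma D_signed_eq: "D_signed n = signed_words n 1 0"
proof -
  have "count_list w (int (Suc n)) = 1 \<and> count_list w (- int (Suc n)) = 0
      \<longleftrightarrow> int (Suc n) \<in> set w"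
    if "mset (map (\<lambda>k. nat \<bar>k\<bar>) w) = add_mset (Suc n) (double_mset n)" for w
  proof -
    have "count_list w (int (Suc n)) + count_list w (- int (Suc n)) = 1"
      using count_list_abs[of "Suc n" w] that by (simp add: count_double_mset_Suc del: mset_map)
    moreover have "int (Suc n) \<in> set w \<longleftrightarrow> count_list w (int (Suc n)) \<noteq> 0"
      by (simp add: count_list_0_iff)
    ultimately show ?thesis by linarith
  qed
  then show ?thesis
    by (auto simp: D_signed_def signed_permutations_of_multiset_def signed_words_def
        permutations_of_multiset_def simp del: mset_map of_nat_Suc)
qed

text \<open>Classification by the signs of the two letters of absolute value
  \<open>n + 1\<close>.\<close>

lemma C_signed_Suc_eq:
  "C_signed (Suc n) = signed_words n 2 0 \<union> signed_words n 1 1 \<union> signed_words n 0 2"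
proof -
  have "(count_list w (int (Suc n)) = 2 \<and> count_list w (- int (Suc n)) = 0) \<or>
      (count_list w (int (Suc n)) = 1 \<and> count_list w (- int (Suc n)) = 1) \<or>
      (count_list w (int (Suc n)) = 0 \<and> count_list w (- int (Suc n)) = 2)"
    if "mset (map (\<lambda>k. nat \<bar>k\<bar>) w) = add_mset (Suc n) (add_mset (Suc n) (double_mset n))" for w
  proof -
    have "count_list w (int (Suc n)) + count_list w (- int (Suc n)) = 2"
      using count_list_abs[of "Suc n" w] that by (simp add: count_double_mset_Suc del: mset_map)
    then show ?thesis by linarith
  qed
  moreover have "w \<in> signed_words n a b \<longleftrightarrow>
      mset (map (\<lambda>k. nat \<bar>k\<bar>) w) = add_mset (Suc n) (add_mset (Suc n) (double_mset n)) \<and>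
      count_list w (int (Suc n)) = a \<and> count_list w (- int (Suc n)) = b" if "a + b = 2" for w a b
    using that by (simp add: signed_words_def numeral_2_eq_2 del: mset_map of_nat_Suc)
  ultimately show ?thesis
    by (simp add: set_eq_iff C_signed_def signed_permutations_of_multiset_def
        permutations_of_multiset_def double_mset_Suc del: mset_map of_nat_Suc) blast
qed

text \<open>The letter \<open>n + 1\<close> is largest; copies of \<open>-(n + 1)\<close> already
  present matter only through the word length.\<close>

lemma des_count_signed_words_max:
  "(real a + 1) * des_count 0 (signed_words n (Suc a) b) k =
     (of_int k + 1 + real a) * des_count 0 (signed_words n a b) k
     + (real (2 * n + a + b) + 1 - of_int k - real a) * des_count 0 (signed_words n a b) (k - 1)"
proof (rule des_count_insert_max[where x = "int (Suc n)", OF _ finite_signed_words finite_signed_words])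
  show "length w = 2 * n + a + b \<and> (\<forall>y\<in>set (0 # w). y \<le> int (Suc n))"
    if "w \<in> signed_words n a b" for w
    using signed_words_bounds[OF that] by force
qed (auto simp: signed_words_def simp del: of_nat_Suc)

lemma des_count_signed_words_min:
  "(real b + 1) * des_count 0 (signed_words n a (Suc b)) k =
     (of_int k + real b) * des_count 0 (signed_words n a b) k
     + (real (2 * n + a + b) + 2 - of_int k - real b) * des_count 0 (signed_words n a b) (k - 1)"
proof (rule des_count_insert_min[where x = "- int (Suc n)", OF _ finite_signed_words finite_signed_words])
  show "length w = 2 * n + a + b \<and> (\<forall>y\<in>set w. - int (Suc n) \<le> y)"
    if "w \<in> signed_words n a b" for w
    using signed_words_bounds[OF that] by force
qed (auto simp: signed_words_def simp del: of_nat_Suc)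

lemma des_count_D_signed:
  "des_count 0 (D_signed n) k = (of_int k + 1) * des_count 0 (C_signed n) k
     + (2 * real n + 1 - of_int k) * des_count 0 (C_signed n) (k - 1)"
  using des_count_signed_words_max[of 0 n 0 k] by (simp add: C_signed_eq D_signed_eq)

text \<open>
  No single insertion produces all of \<open>C_signed (Suc n)\<close> from \<open>D_signed n\<close>; the recurrence only
  appears after summing over the sign patterns of the two new letters and expressing everything
  through \<open>C_signed n\<close>.
\<close>

lemma des_count_C_signed_Suc:
  "des_count 0 (C_signed (Suc n)) k = (2 * of_int k + 1) * des_count 0 (D_signed n) k
     + (4 * real n + 5 - 2 * of_int k) * des_count 0 (D_signed n) (k - 1)"
proof -
  define s where "s = des_count 0 (signed_words n 0 0)"
  define t where "t = des_count 0 (signed_words n 1 0)"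
  define u where "u = des_count 0 (signed_words n 0 1)"
  have t: "t k = (of_int k + 1) * s k + (2 * real n + 1 - of_int k) * s (k - 1)" for k
    using des_count_signed_words_max[of 0 n 0 k] by (simp add: s_def t_def)
  have u: "u k = of_int k * s k + (2 * real n + 2 - of_int k) * s (k - 1)" for k
    using des_count_signed_words_min[of 0 n 0 k] by (simp add: s_def u_def)
  have pp: "2 * des_count 0 (signed_words n 2 0) k =
      (of_int k + 2) * t k + (2 * real n + 1 - of_int k) * t (k - 1)"
    using des_count_signed_words_max[of 1 n 0 k] by (simp add: t_def numeral_2_eq_2 algebra_simps)
  have pm: "des_count 0 (signed_words n 1 1) k =
      of_int k * t k + (2 * real n + 3 - of_int k) * t (k - 1)"
    using des_count_signed_words_min[of 0 n 1 k] by (simp add: t_def algebra_simps)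
  have mm: "2 * des_count 0 (signed_words n 0 2) k =
      (of_int k + 1) * u k + (2 * real n + 2 - of_int k) * u (k - 1)"
    using des_count_signed_words_min[of 1 n 0 k] by (simp add: u_def numeral_2_eq_2 algebra_simps)
  have disjoint: "signed_words n a b \<inter> signed_words n a' b' = {}" if "a \<noteq> a'" for a b a' b'
    using that by (auto simp: signed_words_def)
  have "des_count 0 (C_signed (Suc n)) k = des_count 0 (signed_words n 2 0) k
      + des_count 0 (signed_words n 1 1) k + des_count 0 (signed_words n 0 2) k"
    unfolding C_signed_Suc_eq
    by (simp add: des_count_Un finite_signed_words disjoint Int_Un_distrib2)
  \<comment> \<open>Expanded in \<open>s\<close>, the right-hand sides of \<open>mm\<close> and
    \<open>pm\<close> coincide: both describe words with one letter of each sign, built in the two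
    possible orders. Hence the total can be written in \<open>t\<close> alone.\<close>
  then have "2 * des_count 0 (C_signed (Suc n)) k =
      2 * ((2 * of_int k + 1) * t k + (4 * real n + 5 - 2 * of_int k) * t (k - 1))"
    using pp pm mm unfolding t u by (simp add: algebra_simps)
  then show ?thesis by (simp add: t_def D_signed_eq)
qed

lemma des_count_C_signed_0: "des_count 0 (C_signed 0) k = of_bool (k = 0)"
  by (simp add: C_signed_def signed_permutations_of_multiset_def)

lemma alternatingly_increasing_C_signed_Suc:
  assumes "alternatingly_increasing (2 * int n) (des_count 0 (D_signed n))"
  shows "alternatingly_increasing (2 * int n + 1) (des_count 0 (C_signed (Suc n)))"
proof -
  \<comment> \<open>Halving normalises the coefficient of \<open>k\<close> to 1, which yields
    \<open>a = 1 / 2\<close> and \<open>d = 2 * n + 1\<close>, so that \<open>2 * a = d - N\<close>.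
    Scaling back by 2 preserves all inequalities.\<close>
  have "alternatingly_increasing (2 * int n + 1) (\<lambda>k. des_count 0 (C_signed (Suc n)) k / 2)"
    by (rule alternatingly_increasing_step[OF assms, where a = "1 / 2" and d = "2 * int n + 1"])
      (simp_all add: des_count_C_signed_Suc field_simps)
  then show ?thesis
    by (simp add: alternatingly_increasing_def)
qed

text \<open>Each induction step passes through \<open>C_signed (Suc n)\<close>. Positivity at 0 is
  carried along because it later fixes the degrees.\<close>

lemma alternatingly_increasing_D_signed:
  "alternatingly_increasing (2 * int n) (des_count 0 (D_signed n)) \<and> 0 < des_count 0 (D_signed n) 0"
proof (induction n)
  case 0
  have "des_count 0 (D_signed 0) k = of_bool (k = 0)" for k
    by (auto simp: des_count_D_signed des_count_C_signed_0)
  then show ?case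
    by (simp add: alternatingly_increasing_def)
next
  case (Suc n)
  \<comment> \<open>With \<open>N = 2 * n + 1\<close> the choice \<open>a = 1\<close>,
    \<open>d = 2 * n + 2\<close> meets the upper bound on \<open>2 * a\<close> with
    equality.\<close>
  have "alternatingly_increasing (2 * int n + 1 + 1) (des_count 0 (D_signed (Suc n)))"
    by (rule alternatingly_increasing_step
        [OF alternatingly_increasing_C_signed_Suc[OF conjunct1[OF Suc.IH]],
          where a = 1 and d = "2 * int n + 2"])
      (simp_all add: des_count_D_signed algebra_simps)
  moreover have "0 < des_count 0 (D_signed (Suc n)) 0"
    using Suc.IH by (simp add: des_count_D_signed[of "Suc n"] des_count_C_signed_Suc des_count_neg)
  ultimately show ?case by (simp add: add.commute)
qed

section \<open>Degrees and modes of the three polynomials\<close>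

theorem theorem3:
  fixes n :: nat
  assumes "n \<ge> 1"
  shows "(degree (Q_poly n) = 2 * n - 1 \<and> (degree (Q_poly n) + 1) div 2 = n \<and>
            unimodal_with_mode (Q_poly n) ((degree (Q_poly n) + 1) div 2)) \<and>
         (degree (S_poly n) = 2 * n - 1 \<and> (degree (S_poly n) + 1) div 2 = n \<and>
            unimodal_with_mode (S_poly n) ((degree (S_poly n) + 1) div 2)) \<and>
         (degree (T_poly n) = 2 * n \<and> (degree (T_poly n) + 1) div 2 = n \<and>
            unimodal_with_mode (T_poly n) ((degree (T_poly n) + 1) div 2))"
proof -
  \<comment> \<open>Writing \<open>n = Suc m\<close> turns the degree \<open>2 * n - 1\<close> into
    \<open>2 * m + 1\<close>, free of truncated subtraction.\<close>
  obtain m where n: "n = Suc m"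
    using assms by (cases n) auto
  have "0 < des_count 0 (D_perms n) 0"
    using des_count_C_perms_pos[of n] by (simp add: des_count_D_perms des_count_neg)
  then have Q: "degree (Q_poly n) = 2 * m + 1 \<and> unimodal_with_mode (Q_poly n) ((2 * m + 1 + 1) div 2)"
    using alternatingly_increasing_D_perms[of m]
    by (intro unimodal_if_alternatingly_increasing[where h = "des_count 0 (D_perms n)"])
      (simp_all add: n add.commute Q_poly_def des_Cons_0_nat flip: coeff_sum_monom_des)
  have "0 < des_count 0 (C_signed n) 0"
    using alternatingly_increasing_D_signed[of m] by (simp add: n des_count_C_signed_Suc des_count_neg)
  then have S: "degree (S_poly n) = 2 * m + 1 \<and> unimodal_with_mode (S_poly n) ((2 * m + 1 + 1) div 2)"
    using alternatingly_increasing_C_signed_Suc[of m] alternatingly_increasing_D_signed[of m]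
    by (intro unimodal_if_alternatingly_increasing[where h = "des_count 0 (C_signed n)"])
      (simp_all add: n add.commute S_poly_def des_B_def flip: coeff_sum_monom_des)
  have T: "degree (T_poly n) = 2 * n \<and> unimodal_with_mode (T_poly n) ((2 * n + 1) div 2)"
    using alternatingly_increasing_D_signed[of n]
    by (intro unimodal_if_alternatingly_increasing[where h = "des_count 0 (D_signed n)"])
      (simp_all add: T_poly_def des_B_def flip: coeff_sum_monom_des)
  show ?thesis
    using Q S T by (simp add: n)
qed

end
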